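(* Let $\Delta$ be an additive subgroup of $\mathbb{C}$, let $b\in\mathbb{C}$ with $b\notin\Delta$, and let $\mathcal{A}=\mathcal{A}_{\Delta,\{0\}}$ be the complex vector space with basis $\{x_\alpha\mid\alpha\in\Delta\}$ and Novikov product $x_\alpha\circ x_\beta=(\beta+b)x_{\alpha+\beta}$. A bilinear operation $[\cdot,\cdot]$ on $\mathcal{A}$ makes $(\mathcal{A},[\cdot,\cdot])$ a Lie algebra over the Novikov algebra $(\mathcal{A},\circ)$ if and only if it has the form $$[x_\alpha,x_\beta]=\frac1b\big(\varphi(\beta)\alpha-\varphi(\alpha)\beta+b(\varphi(\beta)-\varphi(\alpha))\big)x_{\alpha+\beta}\qquad\text{for }\alpha,\beta\in\Delta,$$ where $\varphi:\Delta\to\mathbb{C}$ is a homomorphism of additive groups.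
   Context: A Novikov algebra $(\mathcal{A},\circ)$ (over $\mathbb{C}$) satisfies $(u\circ v)\circ w=(u\circ w)\circ v$ and $(u,v,w)=(v,u,w)$, where $(u,v,w)=(u\circ v)\circ w-u\circ(v\circ w)$. A Gel'fand-Dorfman bialgebra is a triple $(\mathcal{A},[\cdot,\cdot],\circ)$ such that $(\mathcal{A},[\cdot,\cdot])$ is a Lie algebra, $(\mathcal{A},\circ)$ is a Novikov algebra and $$[w\circ u,v]-[w\circ v,u]+[w,u]\circ v-[w,v]\circ u-w\circ[u,v]=0\quad\text{for all }u,v,w\in\mathcal{A}.$$ "$(\mathcal{A},[\cdot,\cdot])$ is a Lie algebra over the Novikov algebra $(\mathcal{A},\circ)$" means that $(\mathcal{A},[\cdot,\cdot],\circ)$ is a Gel'fand-Dorfman bialgebra. *)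

theory Defs
  imports Complex_Main
begin

text \<open>
  Algebras live on a linear subspace \<open>A\<close> of an ambient complex vector space, given by
  its scalar multiplication \<open>scale\<close>. Operations are total functions on the ambient type, but
  only their values on \<open>A\<close> matter.
\<close>

locale complex_algebra = vector_space scale
  for scale :: "complex \<Rightarrow> 'a::ab_group_add \<Rightarrow> 'a" +
  fixes A :: "'a set"
    and mult :: "'a \<Rightarrow> 'a \<Rightarrow> 'a"
  assumes subspace_carrier: "subspace A"
    and mult_closed: "\<lbrakk>u \<in> A; v \<in> A\<rbrakk> \<Longrightarrow> mult u v \<in> A"
    and mult_add_left: "\<lbrakk>u \<in> A; v \<in> A; w \<in> A\<rbrakk> \<Longrightarrow> mult (u + v) w = mult u w + mult v w"
    and mult_add_right: "\<lbrakk>u \<in> A; v \<in> A; w \<in> A\<rbrakk> \<Longrightarrow> mult u (v + w) = mult u v + mult u w"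
    and mult_scale_left: "\<lbrakk>u \<in> A; v \<in> A\<rbrakk> \<Longrightarrow> mult (scale c u) v = scale c (mult u v)"
    and mult_scale_right: "\<lbrakk>u \<in> A; v \<in> A\<rbrakk> \<Longrightarrow> mult u (scale c v) = scale c (mult u v)"

locale complex_lie_algebra = complex_algebra scale A bracket
  for scale :: "complex \<Rightarrow> 'a::ab_group_add \<Rightarrow> 'a" and A bracket +
  assumes bracket_self: "u \<in> A \<Longrightarrow> bracket u u = 0"
    and jacobi: "\<lbrakk>u \<in> A; v \<in> A; w \<in> A\<rbrakk> \<Longrightarrow>
      bracket u (bracket v w) + bracket v (bracket w u) + bracket w (bracket u v) = 0"

definition associator :: "('a::ab_group_add \<Rightarrow> 'a \<Rightarrow> 'a) \<Rightarrow> 'a \<Rightarrow> 'a \<Rightarrow> 'a \<Rightarrow> 'a" where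
  "associator mult u v w = mult (mult u v) w - mult u (mult v w)"

locale novikov_algebra = complex_algebra scale A mult
  for scale :: "complex \<Rightarrow> 'a::ab_group_add \<Rightarrow> 'a" and A mult +
  assumes right_commute: "\<lbrakk>u \<in> A; v \<in> A; w \<in> A\<rbrakk> \<Longrightarrow> mult (mult u v) w = mult (mult u w) v"
    and left_symmetric: "\<lbrakk>u \<in> A; v \<in> A; w \<in> A\<rbrakk> \<Longrightarrow>
      associator mult u v w = associator mult v u w"

locale gelfand_dorfman_bialgebra =
  L: complex_lie_algebra scale A bracket + N: novikov_algebra scale A mult
  for scale :: "complex \<Rightarrow> 'a::ab_group_add \<Rightarrow> 'a" and A bracket mult +
  assumes compatible: "\<lbrakk>u \<in> A; v \<in> A; w \<in> A\<rbrakk> \<Longrightarrow>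
    bracket (mult w u) v - bracket (mult w v) u + mult (bracket w u) v
      - mult (bracket w v) u - mult w (bracket u v) = 0"

definition lie_algebra_over_novikov ::
  "(complex \<Rightarrow> 'a::ab_group_add \<Rightarrow> 'a) \<Rightarrow> 'a set \<Rightarrow> ('a \<Rightarrow> 'a \<Rightarrow> 'a) \<Rightarrow> ('a \<Rightarrow> 'a \<Rightarrow> 'a) \<Rightarrow> bool"
  where "lie_algebra_over_novikov scale A mult bracket \<longleftrightarrow>
    gelfand_dorfman_bialgebra scale A bracket mult"

definition add_subgroup :: "'a::ab_group_add set \<Rightarrow> bool" where
  "add_subgroup D \<longleftrightarrow> 0 \<in> D \<and> (\<forall>x\<in>D. \<forall>y\<in>D. x + y \<in> D) \<and> (\<forall>x\<in>D. - x \<in> D)"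

definition add_hom_on :: "'a::ab_group_add set \<Rightarrow> ('a \<Rightarrow> 'b::ab_group_add) \<Rightarrow> bool" where
  "add_hom_on D \<phi> \<longleftrightarrow> (\<forall>x\<in>D. \<forall>y\<in>D. \<phi> (x + y) = \<phi> x + \<phi> y)"

text \<open>The family \<open>x\<close> restricted to \<open>I\<close> is a basis, without repetitions, of the subspace \<open>A\<close>.\<close>

definition indexed_basis ::
  "(complex \<Rightarrow> 'a::ab_group_add \<Rightarrow> 'a) \<Rightarrow> 'i set \<Rightarrow> ('i \<Rightarrow> 'a) \<Rightarrow> 'a set \<Rightarrow> bool" where
  "indexed_basis scale I x A \<longleftrightarrow>
    inj_on x I \<and> \<not> module.dependent scale (x ` I) \<and> module.span scale (x ` I) = A"

end

theory Submission
  imports Defs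
begin

text \<open>
  Left multiplication by \<open>x 0\<close> is diagonal in the basis \<open>x\<close>, with distinct eigenvalues
  \<open>\<delta> + b\<close>. The compatibility condition with \<open>w = u = x 0\<close> and \<open>v = x \<beta>\<close> says that
  \<open>[x 0, x \<beta>]\<close> is an eigenvector for \<open>\<beta> + b\<close>, hence a multiple \<open>\<phi> \<beta>\<close> of \<open>x \<beta>\<close>.
  With \<open>w = x 0\<close>, \<open>u = x \<alpha>\<close> and \<open>v = x \<beta>\<close> it says that the difference of
  \<open>[x \<alpha>, x \<beta>]\<close> and its claimed value is mapped to its multiple by \<open>\<alpha> + \<beta> + 2 b\<close>.
  Since \<open>b\<close> is not in \<open>\<Delta>\<close>, this is not an eigenvalue and the difference vanishes.
  The compatibility condition with \<open>v = x 0\<close> then forces \<open>\<phi>\<close> to be additive.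
  Conversely, the required identities are multilinear, and on basis vectors they become
  polynomial identities. We write \<open>\<psi> = \<phi> / b\<close>, so that
  \<open>[x \<alpha>, x \<beta>] = (\<psi> \<beta> (\<alpha> + b) - \<psi> \<alpha> (\<beta> + b)) x (\<alpha> + \<beta>)\<close>.
\<close>

text \<open>Nothing is assumed about \<open>bracket\<close> on basis vectors, so both directions of
  the equivalence can be proved in this one setting.\<close>

locale two_products =
  N: complex_algebra scale A mult + L: complex_algebra scale A bracket
  for scale :: "complex \<Rightarrow> 'a::ab_group_add \<Rightarrow> 'a" and A mult bracket +
  fixes \<Delta> :: "complex set" and b :: complex and x :: "complex \<Rightarrow> 'a"
  assumes subgroup: "add_subgroup \<Delta>"
    and b_notin: "b \<notin> \<Delta>"
    and basis: "indexed_basis scale \<Delta> x A"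
    and mult_basis: "\<lbrakk>\<alpha> \<in> \<Delta>; \<beta> \<in> \<Delta>\<rbrakk> \<Longrightarrow> mult (x \<alpha>) (x \<beta>) = scale (\<beta> + b) (x (\<alpha> + \<beta>))"
begin

section \<open>Closure properties of the index group and of the carrier\<close>

lemma zero_mem [simp]: "0 \<in> \<Delta>"
  and add_mem [simp]: "\<lbrakk>\<alpha> \<in> \<Delta>; \<beta> \<in> \<Delta>\<rbrakk> \<Longrightarrow> \<alpha> + \<beta> \<in> \<Delta>"
  and uminus_mem [simp]: "\<alpha> \<in> \<Delta> \<Longrightarrow> - \<alpha> \<in> \<Delta>"
  using subgroup unfolding add_subgroup_def by auto

lemma plus_b_nonzero: "\<alpha> \<in> \<Delta> \<Longrightarrow> \<alpha> + b \<noteq> 0"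
  using b_notin uminus_mem by (metis add_eq_0_iff)

lemma b_nonzero [simp]: "b \<noteq> 0"
  using plus_b_nonzero [of 0] by simp

lemma inj_basis: "inj_on x \<Delta>"
  and independent_basis: "N.independent (x ` \<Delta>)"
  and span_basis: "N.span (x ` \<Delta>) = A"
  using basis unfolding indexed_basis_def by auto

lemma basis_mem [simp]: "\<alpha> \<in> \<Delta> \<Longrightarrow> x \<alpha> \<in> A"
  using span_basis N.span_base by blast

lemma add_carrier [simp]: "\<lbrakk>u \<in> A; v \<in> A\<rbrakk> \<Longrightarrow> u + v \<in> A"
  and diff_carrier [simp]: "\<lbrakk>u \<in> A; v \<in> A\<rbrakk> \<Longrightarrow> u - v \<in> A"
  and scale_carrier [simp]: "u \<in> A \<Longrightarrow> scale c u \<in> A"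
  using N.subspace_add N.subspace_diff N.subspace_scale N.subspace_carrier by auto

lemmas closed [simp] = N.mult_closed L.mult_closed

lemmas bilinear [simp] =
  N.mult_add_left N.mult_add_right N.mult_scale_left N.mult_scale_right
  L.mult_add_left L.mult_add_right L.mult_scale_left L.mult_scale_right

lemma mult_diff_right: "\<lbrakk>u \<in> A; v \<in> A; w \<in> A\<rbrakk> \<Longrightarrow> mult u (v - w) = mult u v - mult u w"
  using N.mult_add_right [of u "v - w" w] by (simp del: bilinear)

section \<open>Reduction of multilinear identities to basis vectors\<close>

definition linear_on_carrier :: "('a \<Rightarrow> 'a) \<Rightarrow> bool" where
  "linear_on_carrier f \<longleftrightarrow> (\<forall>u\<in>A. \<forall>v\<in>A. f (u + v) = f u + f v) \<and>
     (\<forall>c. \<forall>u\<in>A. f (scale c u) = scale c (f u))"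

text \<open>The zeros of \<open>f\<close> in \<open>A\<close> form a subspace that contains the
  basis, hence all of \<open>A\<close>.\<close>

lemma linear_eq_0:
  assumes f: "linear_on_carrier f" and f0: "\<And>\<alpha>. \<alpha> \<in> \<Delta> \<Longrightarrow> f (x \<alpha>) = 0" and "u \<in> A"
  shows "f u = 0"
proof -
  \<comment> \<open>Linearity is known on \<open>A\<close> only, so \<open>f 0 = 0\<close> is read
    off from the zero multiple of a vector of \<open>A\<close>.\<close>
  have "f (scale 0 (x 0)) = scale 0 (f (x 0))"
    using f unfolding linear_on_carrier_def by (metis basis_mem zero_mem)
  then have zero: "f 0 = 0"
    by simp
  have "u \<in> N.span (x ` \<Delta>)"
    using \<open>u \<in> A\<close> span_basis by simp
  then have "u \<in> A \<and> f u = 0"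
    by (rule N.span_induct)
      (use f f0 zero N.subspace_0 [OF N.subspace_carrier] in
        \<open>auto simp: N.subspace_def linear_on_carrier_def\<close>)
  then show ?thesis by simp
qed

lemma bilinear_eq_0:
  assumes "\<And>v. v \<in> A \<Longrightarrow> linear_on_carrier (\<lambda>u. F u v)"
    and "\<And>u. u \<in> A \<Longrightarrow> linear_on_carrier (\<lambda>v. F u v)"
    and "\<And>\<alpha> \<beta>. \<lbrakk>\<alpha> \<in> \<Delta>; \<beta> \<in> \<Delta>\<rbrakk> \<Longrightarrow> F (x \<alpha>) (x \<beta>) = 0"
    and "u \<in> A" "v \<in> A"
  shows "F u v = 0"
  by (rule linear_eq_0 [of "\<lambda>u. F u v"], use assms in simp)
    (use assms in \<open>auto intro: linear_eq_0 [of "F (x _)"]\<close>)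

text \<open>One argument at a time is reduced to basis vectors. The Novikov, Jacobi and
  compatibility identities are all checked this way.\<close>

lemma trilinear_eq_0:
  assumes "\<And>v w. \<lbrakk>v \<in> A; w \<in> A\<rbrakk> \<Longrightarrow> linear_on_carrier (\<lambda>u. F u v w)"
    and "\<And>u w. \<lbrakk>u \<in> A; w \<in> A\<rbrakk> \<Longrightarrow> linear_on_carrier (\<lambda>v. F u v w)"
    and "\<And>u v. \<lbrakk>u \<in> A; v \<in> A\<rbrakk> \<Longrightarrow> linear_on_carrier (\<lambda>w. F u v w)"
    and "\<And>\<alpha> \<beta> \<gamma>. \<lbrakk>\<alpha> \<in> \<Delta>; \<beta> \<in> \<Delta>; \<gamma> \<in> \<Delta>\<rbrakk> \<Longrightarrow> F (x \<alpha>) (x \<beta>) (x \<gamma>) = 0"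
    and "u \<in> A" "v \<in> A" "w \<in> A"
  shows "F u v w = 0"
  by (rule linear_eq_0 [of "\<lambda>u. F u v w"], use assms in simp)
    (use assms in \<open>auto intro: bilinear_eq_0 [of "F (x _)"]\<close>)

lemmas scale_distribs =
  N.scale_left_distrib N.scale_left_diff_distrib N.scale_right_distrib N.scale_right_diff_distrib

text \<open>On basis vectors with indices \<alpha>, \<beta>, \<gamma>, the product
  \<open>(u v) w\<close> has coefficient \<open>(\<beta> + b) * (\<gamma> + b)\<close>, symmetric in
  \<beta> and \<gamma>. The associator has coefficient \<open>- \<gamma> * (\<gamma> + b)\<close> at
  \<open>x (\<alpha> + \<beta> + \<gamma>)\<close>, symmetric in \<alpha> and \<beta>.\<close>

lemma novikov: "novikov_algebra scale A mult"
proof unfold_locales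
  fix u v w assume uvw: "u \<in> A" "v \<in> A" "w \<in> A"
  have "mult (mult u v) w - mult (mult u w) v = 0"
    by (rule trilinear_eq_0 [OF _ _ _ _ uvw])
      (auto simp: linear_on_carrier_def scale_distribs mult_basis ac_simps)
  then show "mult (mult u v) w = mult (mult u w) v" by simp
  have "associator mult u v w - associator mult v u w = 0"
    by (rule trilinear_eq_0 [OF _ _ _ _ uvw])
      (auto simp: linear_on_carrier_def associator_def scale_distribs mult_basis algebra_simps)
  then show "associator mult u v w = associator mult v u w" by simp
qed

lemma mult_basis_0_right: "v \<in> A \<Longrightarrow> mult v (x 0) = scale b v"
  using linear_eq_0 [of "\<lambda>v. mult v (x 0) - scale b v" v]
  by (simp add: linear_on_carrier_def scale_distribs mult_basis mult.commute)

section \<open>Coordinates and eigenvectors of left multiplication by \<open>x 0\<close>\<close>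

definition coeff :: "'a \<Rightarrow> complex \<Rightarrow> complex" where
  "coeff v \<delta> = N.representation (x ` \<Delta>) v (x \<delta>)"

lemma coeff_add: "\<lbrakk>u \<in> A; v \<in> A\<rbrakk> \<Longrightarrow> coeff (u + v) \<delta> = coeff u \<delta> + coeff v \<delta>"
  and coeff_diff: "\<lbrakk>u \<in> A; v \<in> A\<rbrakk> \<Longrightarrow> coeff (u - v) \<delta> = coeff u \<delta> - coeff v \<delta>"
  and coeff_scale: "u \<in> A \<Longrightarrow> coeff (scale c u) \<delta> = c * coeff u \<delta>"
  unfolding coeff_def
  by (simp_all add: N.representation_add N.representation_diff N.representation_scale
      independent_basis span_basis)

lemma coeff_basis: "\<lbrakk>\<alpha> \<in> \<Delta>; \<delta> \<in> \<Delta>\<rbrakk> \<Longrightarrow> coeff (x \<alpha>) \<delta> = (if \<delta> = \<alpha> then 1 else 0)"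
  unfolding coeff_def
  using inj_basis by (auto simp: N.representation_basis independent_basis inj_on_eq_iff)

text \<open>\<open>N.representation\<close> vanishes off the basis, so the coordinates indexed by
  \<Delta> are all there are, and \<open>v\<close> is the sum of its nonzero terms.\<close>

lemma coeff_eq_0:
  assumes "v \<in> A" and "\<And>\<delta>. \<delta> \<in> \<Delta> \<Longrightarrow> coeff v \<delta> = 0"
  shows "v = 0"
proof -
  have "N.representation (x ` \<Delta>) v u = 0" for u
    using assms(2) N.representation_ne_zero [of "x ` \<Delta>" v u] unfolding coeff_def by blast
  then show ?thesis
    using N.sum_nonzero_representation_eq [OF independent_basis, of v] assms(1) span_basis by simp
qed

lemma basis_nonzero: "\<alpha> \<in> \<Delta> \<Longrightarrow> x \<alpha> \<noteq> 0"
  using independent_basis N.dependent_zero by (metis image_eqI)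

lemma coeff_mult_basis_0:
  assumes "v \<in> A" "\<delta> \<in> \<Delta>"
  shows "coeff (mult (x 0) v) \<delta> = (\<delta> + b) * coeff v \<delta>"
proof -
  have zero: "0 \<in> A" using N.subspace_0 [OF N.subspace_carrier] .
  have zeros: "mult (x 0) 0 = 0" "coeff 0 \<delta> = 0"
    using N.mult_scale_right [of "x 0" 0 0] coeff_scale [of 0 0] zero by simp_all
  have "v \<in> N.span (x ` \<Delta>)" using assms span_basis by simp
  then have "v \<in> A \<and> coeff (mult (x 0) v) \<delta> = (\<delta> + b) * coeff v \<delta>"
    by (rule N.span_induct)
      (use zero zeros \<open>\<delta> \<in> \<Delta>\<close> in \<open>auto simp: N.subspace_def coeff_add coeff_scale mult_basis
          coeff_basis algebra_simps\<close>)
  then show ?thesis by simp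
qed

text \<open>Comparing coordinates at \<delta> gives \<open>(\<delta> + b) * c = \<mu> * c\<close>
  for the coordinate \<open>c\<close> of \<open>v\<close>.\<close>

lemma eigenvector_coeff_eq_0:
  assumes "v \<in> A" "mult (x 0) v = scale \<mu> v" "\<delta> \<in> \<Delta>" "\<mu> \<noteq> \<delta> + b"
  shows "coeff v \<delta> = 0"
  using coeff_mult_basis_0 [of v \<delta>] coeff_scale [of v \<mu> \<delta>] assms by simp

text \<open>Distinct indices have distinct eigenvalues, so only the coordinate at \<beta> can
  survive.\<close>

lemma eigenvector_basis:
  assumes "v \<in> A" "mult (x 0) v = scale (\<beta> + b) v" "\<beta> \<in> \<Delta>"
  shows "v = scale (coeff v \<beta>) (x \<beta>)"
proof -
  have "v - scale (coeff v \<beta>) (x \<beta>) = 0"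
    by (rule coeff_eq_0)
      (use assms eigenvector_coeff_eq_0 [OF assms(1,2)] in
        \<open>auto simp: coeff_diff coeff_scale coeff_basis\<close>)
  then show ?thesis by simp
qed

section \<open>From an additive map to a Gel'fand-Dorfman bialgebra\<close>

lemma bracket_form_imp_gelfand_dorfman:
  assumes hom: "add_hom_on \<Delta> \<psi>"
    and bracket_basis: "\<And>\<alpha> \<beta>. \<lbrakk>\<alpha> \<in> \<Delta>; \<beta> \<in> \<Delta>\<rbrakk> \<Longrightarrow>
      bracket (x \<alpha>) (x \<beta>) = scale (\<psi> \<beta> * (\<alpha> + b) - \<psi> \<alpha> * (\<beta> + b)) (x (\<alpha> + \<beta>))"
  shows "gelfand_dorfman_bialgebra scale A bracket mult"
proof -
  interpret novikov_algebra scale A mult by (rule novikov)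
  have \<psi>_add [simp]: "\<psi> (\<alpha> + \<beta>) = \<psi> \<alpha> + \<psi> \<beta>" if "\<alpha> \<in> \<Delta>" "\<beta> \<in> \<Delta>" for \<alpha> \<beta>
    using hom that unfolding add_hom_on_def by blast
  show ?thesis
  proof unfold_locales
    fix u assume u: "u \<in> A"
    \<comment> \<open>\<open>bracket u u\<close> is quadratic in \<open>u\<close>, so its polarised
      form is reduced to basis vectors instead, and the factor 2 is then cancelled.\<close>
    have "bracket u u + bracket u u = 0"
      by (rule bilinear_eq_0 [of "\<lambda>u v. bracket u v + bracket v u", OF _ _ _ u u])
        (auto simp: linear_on_carrier_def scale_distribs bracket_basis algebra_simps)
    then have "scale 2 (bracket u u) = 0"
      using N.scale_left_distrib [of 1 1 "bracket u u"] by simp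
    then show "bracket u u = 0"
      using N.scale_eq_0_iff by simp
  next
    fix u v w assume uvw: "u \<in> A" "v \<in> A" "w \<in> A"
    show "bracket u (bracket v w) + bracket v (bracket w u) + bracket w (bracket u v) = 0"
    proof (rule trilinear_eq_0 [OF _ _ _ _ uvw])
      fix \<alpha> \<beta> \<gamma> assume "\<alpha> \<in> \<Delta>" "\<beta> \<in> \<Delta>" "\<gamma> \<in> \<Delta>"
      then show "bracket (x \<alpha>) (bracket (x \<beta>) (x \<gamma>)) + bracket (x \<beta>) (bracket (x \<gamma>) (x \<alpha>)) +
          bracket (x \<gamma>) (bracket (x \<alpha>) (x \<beta>)) = 0"
        \<comment> \<open>The first call merges all terms into one multiple of
          \<open>x (\<alpha> + \<beta> + \<gamma>)\<close>; the second verifies that its coefficient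
          is zero.\<close>
        by (simp add: bracket_basis ac_simps flip: N.scale_left_distrib) (simp add: algebra_simps)
    qed (auto simp: linear_on_carrier_def scale_distribs)
  next
    fix u v w assume uvw: "u \<in> A" "v \<in> A" "w \<in> A"
    show "bracket (mult w u) v - bracket (mult w v) u + mult (bracket w u) v
      - mult (bracket w v) u - mult w (bracket u v) = 0"
    proof (rule trilinear_eq_0 [OF _ _ _ _ uvw])
      fix \<alpha> \<beta> \<gamma> assume "\<alpha> \<in> \<Delta>" "\<beta> \<in> \<Delta>" "\<gamma> \<in> \<Delta>"
      then show "bracket (mult (x \<gamma>) (x \<alpha>)) (x \<beta>) - bracket (mult (x \<gamma>) (x \<beta>)) (x \<alpha>)
          + mult (bracket (x \<gamma>) (x \<alpha>)) (x \<beta>) - mult (bracket (x \<gamma>) (x \<beta>)) (x \<alpha>)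
          - mult (x \<gamma>) (bracket (x \<alpha>) (x \<beta>)) = 0"
        by (simp add: bracket_basis mult_basis ac_simps
            flip: N.scale_left_distrib N.scale_left_diff_distrib) (simp add: algebra_simps)
    qed (auto simp: linear_on_carrier_def scale_distribs)
  qed
qed

section \<open>From a Gel'fand-Dorfman bialgebra to an additive map\<close>

lemma gelfand_dorfman_imp_bracket_form:
  assumes "gelfand_dorfman_bialgebra scale A bracket mult"
  obtains \<psi> where "add_hom_on \<Delta> \<psi>"
    and "\<And>\<alpha> \<beta>. \<lbrakk>\<alpha> \<in> \<Delta>; \<beta> \<in> \<Delta>\<rbrakk> \<Longrightarrow>
      bracket (x \<alpha>) (x \<beta>) = scale (\<psi> \<beta> * (\<alpha> + b) - \<psi> \<alpha> * (\<beta> + b)) (x (\<alpha> + \<beta>))"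
proof -
  interpret gelfand_dorfman_bialgebra scale A bracket mult by fact
  have skew: "bracket v u = - bracket u v" if "u \<in> A" "v \<in> A" for u v
  proof -
    have "bracket u u + bracket u v + (bracket v u + bracket v v) = 0"
      using L.bracket_self [of "u + v"] that by (simp add: ac_simps)
    then show ?thesis
      using that L.bracket_self by (simp add: add_eq_0_iff)
  qed
  define \<phi> where "\<phi> \<beta> = coeff (bracket (x 0) (x \<beta>)) \<beta>" for \<beta>
  have \<phi>: "bracket (x 0) (x \<beta>) = scale (\<phi> \<beta>) (x \<beta>)" if \<beta>: "\<beta> \<in> \<Delta>" for \<beta>
    unfolding \<phi>_def
  proof (rule eigenvector_basis)
    define y where "y = bracket (x 0) (x \<beta>)"
    have y: "y \<in> A" unfolding y_def using \<beta> by simp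
    \<comment> \<open>The term with \<open>bracket (x 0) (x 0)\<close> drops out, for which
      \<open>N.mult_scale_left\<close> supplies \<open>mult 0 (x \<beta>) = 0\<close>. The two
      \<open>scale b y\<close> cancel and leave the eigenvector equation.\<close>
    have "scale b y + scale (\<beta> + b) y - scale b y - mult (x 0) y = 0"
      using compatible [of "x 0" "x \<beta>" "x 0"] \<beta> y skew [of "x 0" "x \<beta>"] N.mult_scale_left [of 0 "x \<beta>" 0]
        N.subspace_0 [OF N.subspace_carrier]
      by (simp add: mult_basis L.bracket_self mult_basis_0_right flip: y_def)
    then show "mult (x 0) (bracket (x 0) (x \<beta>)) = scale (\<beta> + b) (bracket (x 0) (x \<beta>))"
      by (simp add: y_def)
  qed (use \<beta> in auto)
  define \<psi> where "\<psi> \<beta> = \<phi> \<beta> / b" for \<beta>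
  have \<phi>_\<psi>: "\<phi> \<beta> = b * \<psi> \<beta>" for \<beta>
    by (simp add: \<psi>_def)
  have form: "bracket (x \<alpha>) (x \<beta>) = scale (\<psi> \<beta> * (\<alpha> + b) - \<psi> \<alpha> * (\<beta> + b)) (x (\<alpha> + \<beta>))"
    if mem: "\<alpha> \<in> \<Delta>" "\<beta> \<in> \<Delta>" for \<alpha> \<beta>
  proof -
    define t where "t = \<psi> \<beta> * (\<alpha> + b) - \<psi> \<alpha> * (\<beta> + b)"
    define y where "y = bracket (x \<alpha>) (x \<beta>)"
    define z where "z = y - scale t (x (\<alpha> + \<beta>))"
    have y: "y \<in> A" and z: "z \<in> A"
      unfolding y_def z_def using mem by simp_all
    have "scale (\<alpha> + b) y + scale (\<beta> + b) y + scale (\<phi> \<alpha> * (\<beta> + b)) (x (\<alpha> + \<beta>))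
        - scale (\<phi> \<beta> * (\<alpha> + b)) (x (\<alpha> + \<beta>)) - mult (x 0) y = 0"
      using compatible [of "x \<alpha>" "x \<beta>" "x 0"] mem y skew [of "x \<alpha>" "x \<beta>"]
      by (simp add: mult_basis \<phi> add.commute [of \<beta> \<alpha>] flip: y_def)
    \<comment> \<open>This is an inhomogeneous eigenvector equation for \<open>y\<close>. Since
      \<open>x (\<alpha> + \<beta>)\<close> has eigenvalue \<open>\<alpha> + \<beta> + b\<close>,
      its multiple by \<open>t\<close> is a particular solution, and the difference \<open>z\<close>
      solves the homogeneous equation.\<close>
    then have "mult (x 0) y = scale (\<alpha> + b) y + scale (\<beta> + b) y - scale (b * t) (x (\<alpha> + \<beta>))"
      unfolding t_def \<phi>_\<psi> by (simp add: scale_distribs algebra_simps)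
    then have "mult (x 0) z = scale (\<alpha> + b) z + scale (\<beta> + b) z"
      using y mem unfolding z_def
      by (simp add: mult_diff_right mult_basis scale_distribs algebra_simps)
    then have "mult (x 0) z = scale (\<alpha> + b + (\<beta> + b)) z"
      by (simp only: N.scale_left_distrib)
    moreover have "\<alpha> + b + (\<beta> + b) \<noteq> \<delta> + b" if "\<delta> \<in> \<Delta>" for \<delta>
    proof
      assume "\<alpha> + b + (\<beta> + b) = \<delta> + b"
      then have "b = \<delta> + - (\<alpha> + \<beta>)" by algebra
      moreover have "\<delta> + - (\<alpha> + \<beta>) \<in> \<Delta>" using that mem by (intro add_mem uminus_mem)
      ultimately show False using b_notin by simp
    qed
    ultimately have "z = 0"
      by (intro coeff_eq_0 eigenvector_coeff_eq_0) (use z in auto)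
    then show ?thesis unfolding z_def y_def t_def by simp
  qed
  have \<psi>_0: "\<psi> 0 = 0"
    using \<phi> [of 0] L.bracket_self [of "x 0"] basis_nonzero [of 0] N.scale_eq_0_iff [of "\<phi> 0" "x 0"]
    by (simp add: \<psi>_def)
  have "\<psi> (\<gamma> + \<alpha>) = \<psi> \<gamma> + \<psi> \<alpha>" if mem: "\<gamma> \<in> \<Delta>" "\<alpha> \<in> \<Delta>" for \<gamma> \<alpha>
  proof -
    \<comment> \<open>The two terms in \<open>bracket (x \<gamma>) (x \<alpha>)\<close> cancel
      because right multiplication by \<open>x 0\<close> is the scalar \<open>b\<close>. By
      \<open>\<psi> 0 = 0\<close>, each remaining bracket with \<open>x 0\<close> contributes a
      factor \<open>b\<close> and one value of \<psi>.\<close>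
    have "(\<alpha> + b) * b * (\<psi> \<gamma> + \<psi> \<alpha> - \<psi> (\<gamma> + \<alpha>)) = 0"
      using compatible [of "x \<alpha>" "x 0" "x \<gamma>"] mem basis_nonzero [of "\<gamma> + \<alpha>"] \<psi>_0
      by (simp add: form mult_basis add.commute [of \<alpha> \<gamma>] N.scale_eq_0_iff
          del: N.scale_minus_left mult_eq_0_iff
          flip: N.scale_left_distrib N.scale_left_diff_distrib)
        (simp add: algebra_simps del: mult_eq_0_iff)
    then show ?thesis
      using mem plus_b_nonzero [of \<alpha>] by simp
  qed
  then have "add_hom_on \<Delta> \<psi>"
    unfolding add_hom_on_def by blast
  then show thesis using form that by blast
qed

end

theorem theorem4p2:
  fixes \<Delta> :: "complex set"
    and b :: complex
    and scale :: "complex \<Rightarrow> 'a::ab_group_add \<Rightarrow> 'a"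
    and A :: "'a set"
    and x :: "complex \<Rightarrow> 'a"
    and mult bracket :: "'a \<Rightarrow> 'a \<Rightarrow> 'a"
  assumes "add_subgroup \<Delta>"
    and "b \<notin> \<Delta>"
    and "vector_space scale"
    and "indexed_basis scale \<Delta> x A"
    and "complex_algebra scale A mult"
    and "\<And>\<alpha> \<beta>. \<alpha> \<in> \<Delta> \<Longrightarrow> \<beta> \<in> \<Delta> \<Longrightarrow> mult (x \<alpha>) (x \<beta>) = scale (\<beta> + b) (x (\<alpha> + \<beta>))"
    and "complex_algebra scale A bracket"
  shows "lie_algebra_over_novikov scale A mult bracket \<longleftrightarrow>
    (\<exists>\<phi> :: complex \<Rightarrow> complex. add_hom_on \<Delta> \<phi> \<and>
      (\<forall>\<alpha>\<in>\<Delta>. \<forall>\<beta>\<in>\<Delta>. bracket (x \<alpha>) (x \<beta>) =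
        scale (1 / b * (\<phi> \<beta> * \<alpha> - \<phi> \<alpha> * \<beta> + b * (\<phi> \<beta> - \<phi> \<alpha>))) (x (\<alpha> + \<beta>))))"
proof -
  interpret N: complex_algebra scale A mult by fact
  interpret L: complex_algebra scale A bracket by fact
  interpret two_products scale A mult bracket \<Delta> b x
    by unfold_locales (use assms in auto)
  show ?thesis unfolding lie_algebra_over_novikov_def
  proof
    assume "gelfand_dorfman_bialgebra scale A bracket mult"
    then obtain \<psi> where hom: "add_hom_on \<Delta> \<psi>"
      and form: "\<And>\<alpha> \<beta>. \<lbrakk>\<alpha> \<in> \<Delta>; \<beta> \<in> \<Delta>\<rbrakk> \<Longrightarrow>
        bracket (x \<alpha>) (x \<beta>) = scale (\<psi> \<beta> * (\<alpha> + b) - \<psi> \<alpha> * (\<beta> + b)) (x (\<alpha> + \<beta>))"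
      using gelfand_dorfman_imp_bracket_form by blast
    show "\<exists>\<phi>. add_hom_on \<Delta> \<phi> \<and> (\<forall>\<alpha>\<in>\<Delta>. \<forall>\<beta>\<in>\<Delta>. bracket (x \<alpha>) (x \<beta>) =
        scale (1 / b * (\<phi> \<beta> * \<alpha> - \<phi> \<alpha> * \<beta> + b * (\<phi> \<beta> - \<phi> \<alpha>))) (x (\<alpha> + \<beta>)))"
    \<comment> \<open>The stated coefficient regroups as \<open>(\<phi> \<beta> * (\<alpha> + b) -
      \<phi> \<alpha> * (\<beta> + b)) / b\<close>, so multiplying \<psi> by \<open>b\<close> undoes
      the normalisation.\<close>
    proof (intro exI [of _ "\<lambda>\<alpha>. b * \<psi> \<alpha>"] conjI ballI)
      show "add_hom_on \<Delta> (\<lambda>\<alpha>. b * \<psi> \<alpha>)"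
        using hom by (simp add: add_hom_on_def distrib_left)
    next
      fix \<alpha> \<beta> assume "\<alpha> \<in> \<Delta>" "\<beta> \<in> \<Delta>"
      moreover have "1 / b * (b * \<psi> \<beta> * \<alpha> - b * \<psi> \<alpha> * \<beta> + b * (b * \<psi> \<beta> - b * \<psi> \<alpha>)) =
          \<psi> \<beta> * (\<alpha> + b) - \<psi> \<alpha> * (\<beta> + b)"
        by (simp add: field_simps)
      ultimately show "bracket (x \<alpha>) (x \<beta>) =
          scale (1 / b * (b * \<psi> \<beta> * \<alpha> - b * \<psi> \<alpha> * \<beta> + b * (b * \<psi> \<beta> - b * \<psi> \<alpha>))) (x (\<alpha> + \<beta>))"
        using form by simp
    qed
  next
    assume "\<exists>\<phi>. add_hom_on \<Delta> \<phi> \<and> (\<forall>\<alpha>\<in>\<Delta>. \<forall>\<beta>\<in>\<Delta>. bracket (x \<alpha>) (x \<beta>) =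
        scale (1 / b * (\<phi> \<beta> * \<alpha> - \<phi> \<alpha> * \<beta> + b * (\<phi> \<beta> - \<phi> \<alpha>))) (x (\<alpha> + \<beta>)))"
    then obtain \<phi> where "add_hom_on \<Delta> \<phi>"
      and "\<And>\<alpha> \<beta>. \<lbrakk>\<alpha> \<in> \<Delta>; \<beta> \<in> \<Delta>\<rbrakk> \<Longrightarrow> bracket (x \<alpha>) (x \<beta>) =
        scale (1 / b * (\<phi> \<beta> * \<alpha> - \<phi> \<alpha> * \<beta> + b * (\<phi> \<beta> - \<phi> \<alpha>))) (x (\<alpha> + \<beta>))"
      by blast
    then show "gelfand_dorfman_bialgebra scale A bracket mult"
      by (intro bracket_form_imp_gelfand_dorfman [of "\<lambda>\<alpha>. \<phi> \<alpha> / b"])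
        (simp_all add: add_hom_on_def field_simps)
  qed
qed

end
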